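(* Let $\varepsilon,\tau_1,\tau_2>0$, let $X$ and $Y$ be complete separable metric spaces, let $\mu\in\mathcal{M}_+(X)$, $\nu\in\mathcal{M}_+(Y)$ be positive measures, and let $c\in L^\infty(X\times Y)$ be a cost function. For $u^*\in L^\infty(X)$ and $v^*\in L^\infty(Y)$ the following are equivalent: (a) (Maximizers) $(u^*,v^* )$ maximizes $D^{\tau_1,\tau_2}_{\varepsilon}(u,v)$ over all $u\in L^\infty(X)$, $v\in L^\infty(Y)$; (b) (Maximality condition) $(u^* )^{(c,\tau_2,\varepsilon)}=v^*$ and $(v^* )^{(c,\tau_1,\varepsilon)}=u^*$; (c) (Duality attainment) $\mathcal{OT}^{\tau_1,\tau_2}_{\varepsilon}(\mu,\nu)=D^{\tau_1,\tau_2}_{\varepsilon}(u^*,v^* )$. Moreover, for $u^*,v^*$ satisfying these conditions, the measure $\gamma^*$ defined by $$d\gamma^*=\exp\left(\frac{u^*(x)+v^*(y)-c(x,y)}{\varepsilon}\right)d(\mu\otimes\nu)$$ is the (unique) minimizer of the problem defining $\mathcal{OT}^{\tau_1,\tau_2}_{\varepsilon}(\mu,\nu)$.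
   Context: $\mathcal{M}_+(Z)$ denotes the positive (finite, nonnegative Borel) measures on $Z$; the measures $\mu,\nu$ are finite and nonzero, i.e. $0<\mu(X)<\infty$ and $0<\nu(Y)<\infty$. $L^\infty(X)$, $L^\infty(Y)$, $L^\infty(X\times Y)$ are the spaces of real-valued essentially bounded measurable functions with respect to $\mu$, $\nu$, $\mu\otimes\nu$ respectively (functions equal a.e. are identified). Dual functional: for $u\in L^\infty(X)$, $v\in L^\infty(Y)$, $$D^{\tau_1,\tau_2}_{\varepsilon}(u,v)=-\tau_1\int_X\left(e^{-u/\tau_1}-1\right)d\mu-\tau_2\int_Y\left(e^{-v/\tau_2}-1\right)d\nu-\varepsilon\int_{X\times Y}e^{\frac{u+v-c}{\varepsilon}}\,d(\mu\otimes\nu).$$ Unbalanced entropic $c$-transforms: $$u^{(c,\tau_2,\varepsilon)}(y)=-\frac{\tau_2\varepsilon}{\tau_2+\varepsilon}\log\int_X\exp\left(\frac{u(x)-c(x,y)}{\varepsilon}\right)d\mu(x),$$ $$v^{(c,\tau_1,\varepsilon)}(x)=-\frac{\tau_1\varepsilon}{\tau_1+\varepsilon}\log\int_Y\exp\left(\frac{v(y)-c(x,y)}{\varepsilon}\right)d\nu(y).$$ Primal problem (Shannon-entropy regularized unbalanced optimal transport): $$\mathcal{OT}^{\tau_1,\tau_2}_{\varepsilon}(\mu,\nu)=\inf_{\gamma\in\mathcal{M}_+(X\times Y)}\int_{X\times Y}c\,d\gamma+\varepsilon S(\gamma)+\tau_1\mathrm{KL}((e_1)_\sharp\gamma|\mu)+\tau_2\mathrm{KL}((e_2)_\sharp\gamma|\nu),$$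 where $e_1(x,y)=x$, $e_2(x,y)=y$, $(e_i)_\sharp\gamma$ is the push-forward of $\gamma$ by $e_i$, $$\mathrm{KL}(\alpha|\beta)=\int\left[\frac{d\alpha}{d\beta}\left(\log\frac{d\alpha}{d\beta}-1\right)+1\right]d\beta\ \text{ if }\alpha\ll\beta,\qquad \mathrm{KL}(\alpha|\beta)=+\infty\ \text{ otherwise},$$ $$S(\gamma)=\int_{X\times Y}\frac{d\gamma}{d(\mu\otimes\nu)}\left(\log\frac{d\gamma}{d(\mu\otimes\nu)}-1\right)d(\mu\otimes\nu)\ \text{ if }\gamma\ll\mu\otimes\nu,\qquad S(\gamma)=+\infty\ \text{ otherwise},$$ with $0\log 0=0$. The whole objective is understood to be $+\infty$ when $\gamma\not\ll\mu\otimes\nu$. *)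

theory Defs
  imports "HOL-Analysis.Analysis"
begin

definition pos_measures :: "'a::topological_space measure set" where
  "pos_measures = {M. sets M = sets borel \<and> finite_measure M}"

text \<open>Elements of \<open>L\<^sup>\<infinity>\<close> are given by representatives; identities between them are
  accordingly stated almost everywhere.\<close>

definition Linf :: "'a measure \<Rightarrow> ('a \<Rightarrow> real) set" where
  "Linf M = {f \<in> borel_measurable M. \<exists>C. AE x in M. \<bar>f x\<bar> \<le> C}"

text \<open>The Lebesgue integral with values in the extended reals, meaningful when the positive or the
  negative part has finite integral. The integrands below are bounded from below and the reference
  measures are finite.\<close>

definition ext_integral :: "'a measure \<Rightarrow> ('a \<Rightarrow> real) \<Rightarrow> ereal" where
  "ext_integral M f =
     enn2ereal (\<integral>\<^sup>+x. ennreal (f x) \<partial>M) - enn2ereal (\<integral>\<^sup>+x. ennreal (- f x) \<partial>M)"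

text \<open>A real-valued version of $d\alpha/d\beta$; for finite \<open>\<alpha>\<close> the library's \<open>RN_deriv\<close> is finite
  \<open>\<beta>\<close>-almost everywhere. Note the argument order: reference measure first in \<open>RN_deriv\<close> and
  \<open>absolutely_continuous\<close>.\<close>

definition dens :: "'a measure \<Rightarrow> 'a measure \<Rightarrow> 'a \<Rightarrow> real" where
  "dens \<alpha> \<beta> x = enn2real (RN_deriv \<beta> \<alpha> x)"

definition KL :: "'a measure \<Rightarrow> 'a measure \<Rightarrow> ereal" where
  "KL \<alpha> \<beta> =
     (if absolutely_continuous \<beta> \<alpha>
      then ext_integral \<beta> (\<lambda>x. dens \<alpha> \<beta> x * (ln (dens \<alpha> \<beta> x) - 1) + 1)
      else \<infinity>)"

text \<open>Shannon entropy of \<open>\<gamma>\<close> relative to the reference measure \<open>\<pi>\<close>, to be used with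
  \<open>\<pi> = \<mu> \<Otimes>\<^sub>M \<nu>\<close>.\<close>

definition shannon :: "'a measure \<Rightarrow> 'a measure \<Rightarrow> ereal" where
  "shannon \<pi> \<gamma> =
     (if absolutely_continuous \<pi> \<gamma>
      then ext_integral \<pi> (\<lambda>z. dens \<gamma> \<pi> z * (ln (dens \<gamma> \<pi> z) - 1))
      else \<infinity>)"

text \<open>Where \<open>\<gamma> \<lless> \<mu> \<otimes> \<nu>\<close>, the cost is \<open>\<gamma>\<close>-essentially bounded, so the Bochner integral is the
  genuine one; otherwise it would depend on the representative of the cost, and the objective is set
  to \<open>\<infinity>\<close>.\<close>

definition primal ::
  "'a::topological_space measure \<Rightarrow> 'b::topological_space measure \<Rightarrow> ('a \<times> 'b \<Rightarrow> real) \<Rightarrow>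
   real \<Rightarrow> real \<Rightarrow> real \<Rightarrow> ('a \<times> 'b) measure \<Rightarrow> ereal" where
  "primal \<mu> \<nu> c \<epsilon> \<tau>\<^sub>1 \<tau>\<^sub>2 \<gamma> =
     (if absolutely_continuous (\<mu> \<Otimes>\<^sub>M \<nu>) \<gamma>
      then ereal (\<integral>z. c z \<partial>\<gamma>) + ereal \<epsilon> * shannon (\<mu> \<Otimes>\<^sub>M \<nu>) \<gamma>
           + ereal \<tau>\<^sub>1 * KL (distr \<gamma> borel fst) \<mu> + ereal \<tau>\<^sub>2 * KL (distr \<gamma> borel snd) \<nu>
      else \<infinity>)"

definition OT ::
  "'a::topological_space measure \<Rightarrow> 'b::topological_space measure \<Rightarrow> ('a \<times> 'b \<Rightarrow> real) \<Rightarrow>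
   real \<Rightarrow> real \<Rightarrow> real \<Rightarrow> ereal" where
  "OT \<mu> \<nu> c \<epsilon> \<tau>\<^sub>1 \<tau>\<^sub>2 = (INF \<gamma>\<in>pos_measures. primal \<mu> \<nu> c \<epsilon> \<tau>\<^sub>1 \<tau>\<^sub>2 \<gamma>)"

definition dual ::
  "'a measure \<Rightarrow> 'b measure \<Rightarrow> ('a \<times> 'b \<Rightarrow> real) \<Rightarrow> real \<Rightarrow> real \<Rightarrow> real \<Rightarrow>
   ('a \<Rightarrow> real) \<Rightarrow> ('b \<Rightarrow> real) \<Rightarrow> real" where
  "dual \<mu> \<nu> c \<epsilon> \<tau>\<^sub>1 \<tau>\<^sub>2 u v =
     - \<tau>\<^sub>1 * (\<integral>x. (exp (- u x / \<tau>\<^sub>1) - 1) \<partial>\<mu>) - \<tau>\<^sub>2 * (\<integral>y. (exp (- v y / \<tau>\<^sub>2) - 1) \<partial>\<nu>)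
     - \<epsilon> * (\<integral>(x, y). exp ((u x + v y - c (x, y)) / \<epsilon>) \<partial>(\<mu> \<Otimes>\<^sub>M \<nu>))"

text \<open>The $c$-transforms of a potential on the first and on the second space, respectively.\<close>

definition c_transform_fst ::
  "'a measure \<Rightarrow> ('a \<times> 'b \<Rightarrow> real) \<Rightarrow> real \<Rightarrow> real \<Rightarrow> ('a \<Rightarrow> real) \<Rightarrow> 'b \<Rightarrow> real" where
  "c_transform_fst \<mu> c \<tau>\<^sub>2 \<epsilon> u y =
     - (\<tau>\<^sub>2 * \<epsilon> / (\<tau>\<^sub>2 + \<epsilon>)) * ln (\<integral>x. exp ((u x - c (x, y)) / \<epsilon>) \<partial>\<mu>)"

definition c_transform_snd ::
  "'b measure \<Rightarrow> ('a \<times> 'b \<Rightarrow> real) \<Rightarrow> real \<Rightarrow> real \<Rightarrow> ('b \<Rightarrow> real) \<Rightarrow> 'a \<Rightarrow> real" where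
  "c_transform_snd \<nu> c \<tau>\<^sub>1 \<epsilon> v x =
     - (\<tau>\<^sub>1 * \<epsilon> / (\<tau>\<^sub>1 + \<epsilon>)) * ln (\<integral>y. exp ((v y - c (x, y)) / \<epsilon>) \<partial>\<nu>)"

definition is_dual_maximizer ::
  "'a measure \<Rightarrow> 'b measure \<Rightarrow> ('a \<times> 'b \<Rightarrow> real) \<Rightarrow> real \<Rightarrow> real \<Rightarrow> real \<Rightarrow>
   ('a \<Rightarrow> real) \<Rightarrow> ('b \<Rightarrow> real) \<Rightarrow> bool" where
  "is_dual_maximizer \<mu> \<nu> c \<epsilon> \<tau>\<^sub>1 \<tau>\<^sub>2 u' v' \<longleftrightarrow>
     u' \<in> Linf \<mu> \<and> v' \<in> Linf \<nu> \<and>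
     (\<forall>u\<in>Linf \<mu>. \<forall>v\<in>Linf \<nu>. dual \<mu> \<nu> c \<epsilon> \<tau>\<^sub>1 \<tau>\<^sub>2 u v \<le> dual \<mu> \<nu> c \<epsilon> \<tau>\<^sub>1 \<tau>\<^sub>2 u' v')"

definition maximality_condition ::
  "'a measure \<Rightarrow> 'b measure \<Rightarrow> ('a \<times> 'b \<Rightarrow> real) \<Rightarrow> real \<Rightarrow> real \<Rightarrow> real \<Rightarrow>
   ('a \<Rightarrow> real) \<Rightarrow> ('b \<Rightarrow> real) \<Rightarrow> bool" where
  "maximality_condition \<mu> \<nu> c \<epsilon> \<tau>\<^sub>1 \<tau>\<^sub>2 u v \<longleftrightarrow>
     (AE y in \<nu>. c_transform_fst \<mu> c \<tau>\<^sub>2 \<epsilon> u y = v y) \<and>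
     (AE x in \<mu>. c_transform_snd \<nu> c \<tau>\<^sub>1 \<epsilon> v x = u x)"

definition is_primal_minimizer ::
  "'a::topological_space measure \<Rightarrow> 'b::topological_space measure \<Rightarrow> ('a \<times> 'b \<Rightarrow> real) \<Rightarrow>
   real \<Rightarrow> real \<Rightarrow> real \<Rightarrow> ('a \<times> 'b) measure \<Rightarrow> bool" where
  "is_primal_minimizer \<mu> \<nu> c \<epsilon> \<tau>\<^sub>1 \<tau>\<^sub>2 \<gamma> \<longleftrightarrow>
     \<gamma> \<in> pos_measures \<and> primal \<mu> \<nu> c \<epsilon> \<tau>\<^sub>1 \<tau>\<^sub>2 \<gamma> = OT \<mu> \<nu> c \<epsilon> \<tau>\<^sub>1 \<tau>\<^sub>2"

definition gibbs ::
  "'a measure \<Rightarrow> 'b measure \<Rightarrow> ('a \<times> 'b \<Rightarrow> real) \<Rightarrow> real \<Rightarrow>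
   ('a \<Rightarrow> real) \<Rightarrow> ('b \<Rightarrow> real) \<Rightarrow> ('a \<times> 'b) measure" where
  "gibbs \<mu> \<nu> c \<epsilon> u v =
     density (\<mu> \<Otimes>\<^sub>M \<nu>) (\<lambda>(x, y). ennreal (exp ((u x + v y - c (x, y)) / \<epsilon>)))"

end

theory Submission
  imports Defs
begin

text \<open>Put $G(t, w) = t (\log t - 1 - w) + e^w$, which is nonnegative for $t \ge 0$ and vanishes only
  at $t = e^w$ (Fenchel-Young for the entropy). For a plan \<open>\<gamma>\<close> of finite cost with density $g$ and
  marginal densities $a$, $b$, the primal value minus $D(u, v)$ equals
  $$\varepsilon \int G(g, (u + v - c)/\varepsilon)\, d(\mu\otimes\nu)
    + \tau_1 \int G(a, -u/\tau_1)\, d\mu + \tau_2 \int G(b, -v/\tau_2)\, d\nu.$$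
  Hence weak duality holds, equality forces \<open>\<gamma>\<close> to be the Gibbs measure of $(u, v)$, and for the Gibbs
  measure all three terms vanish as soon as its marginal densities are $e^{-u/\tau_1}$ and
  $e^{-v/\tau_2}$, which is the maximality condition. Conversely, with one potential frozen the dual
  functional is the integral of a strictly concave function of the other one, whose pointwise
  maximizer is the $c$-transform; so a maximizing pair satisfies the maximality condition. No
  existence result for either problem is needed.\<close>

section \<open>Entropy and densities\<close>

text \<open>The Fenchel-Young gap between the entropy \<open>t * (ln t - 1)\<close> and its
  conjugate \<open>exp w\<close>. At \<open>t = 0\<close> the product vanishes, in line with the
  convention 0 log 0 = 0.\<close>

definition kl_gap :: "real \<Rightarrow> real \<Rightarrow> real" where
  "kl_gap t w = t * (ln t - 1 - w) + exp w"

text \<open>Factoring out \<open>t\<close> leaves r - 1 - ln r in the ratio r =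
  \<open>exp w / t\<close>, which is nonnegative and vanishes only at r = 1. The sign and the
  equality case of the gap are read off from this.\<close>

lemma kl_gap_eq:
  assumes "t > 0"
  shows "kl_gap t w = t * (exp w / t - 1 - ln (exp w / t))"
  using assms by (simp add: kl_gap_def ln_div algebra_simps)

lemma kl_gap_nonneg:
  assumes "t \<ge> 0"
  shows "kl_gap t w \<ge> 0"
proof (cases "t = 0")
  case False
  then have "t > 0" using assms by simp
  moreover have "ln (exp w / t) \<le> exp w / t - 1"
    using \<open>t > 0\<close> by (intro ln_le_minus_one) simp
  ultimately show ?thesis unfolding kl_gap_eq[OF \<open>t > 0\<close>] by (intro mult_nonneg_nonneg) auto
qed (simp add: kl_gap_def)

lemma kl_gap_eq_0_iff:
  assumes "t \<ge> 0"
  shows "kl_gap t w = 0 \<longleftrightarrow> t = exp w"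
proof (cases "t = 0")
  case False
  then have t: "t > 0" using assms by simp
  show ?thesis
  proof
    assume "kl_gap t w = 0"
    then have "ln (exp w / t) = exp w / t - 1"
      using t unfolding kl_gap_eq[OF t] by simp
    then have "exp w / t = 1" using t by (intro ln_eq_minus_one) auto
    then show "t = exp w" using t by simp
  qed (simp add: kl_gap_def algebra_simps)
qed (simp add: kl_gap_def)

text \<open>The case \<open>w = 0\<close> of the Fenchel-Young inequality. It bounds entropy
  integrands from below, so over a finite measure their negative parts have finite integral.\<close>

lemma entropy_ge_neg_one:
  fixes t :: real
  assumes "t \<ge> 0"
  shows "- 1 \<le> t * (ln t - 1)"
  using kl_gap_nonneg[OF assms, of 0] by (simp add: kl_gap_def)

text \<open>Over a finite measure the lower bound controls the negative part, so integrability can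
  fail only through an infinite positive part; the difference is then infinity and never
  undetermined.\<close>

lemma ext_integral_bounded_below:
  assumes "finite_measure M" and [measurable]: "f \<in> borel_measurable M"
    and lower: "\<And>x. - K \<le> f x"
  shows "ext_integral M f = (if integrable M f then ereal (\<integral>x. f x \<partial>M) else \<infinity>)"
proof -
  interpret finite_measure M by fact
  have "(\<integral>\<^sup>+x. ennreal (- f x) \<partial>M) \<le> (\<integral>\<^sup>+x. ennreal K \<partial>M)"
    using lower by (intro nn_integral_mono ennreal_leI) (simp add: minus_le_iff)
  also have "\<dots> < \<infinity>"
    by (simp add: ennreal_mult_less_top emeasure_eq_measure)
  finally have neg: "(\<integral>\<^sup>+x. ennreal (- f x) \<partial>M) < \<infinity>" .
  show ?thesis
  proof (cases "integrable M f")
    case True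
    then have pos: "(\<integral>\<^sup>+x. ennreal (f x) \<partial>M) < \<infinity>"
      by (simp add: real_integrable_def top.not_eq_extremum)
    obtain a where a: "a \<ge> 0" "(\<integral>\<^sup>+x. ennreal (f x) \<partial>M) = ennreal a"
      using pos by (cases "\<integral>\<^sup>+x. ennreal (f x) \<partial>M") auto
    obtain b where b: "b \<ge> 0" "(\<integral>\<^sup>+x. ennreal (- f x) \<partial>M) = ennreal b"
      using neg by (cases "\<integral>\<^sup>+x. ennreal (- f x) \<partial>M") auto
    show ?thesis
      using True a b by (simp add: ext_integral_def real_lebesgue_integral_def enn2ereal_ennreal)
  next
    case False
    then have "(\<integral>\<^sup>+x. ennreal (f x) \<partial>M) = \<infinity>"
      using neg by (auto simp: real_integrable_def)
    moreover obtain b where b: "b \<ge> 0" "(\<integral>\<^sup>+x. ennreal (- f x) \<partial>M) = ennreal b"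
      using neg by (cases "\<integral>\<^sup>+x. ennreal (- f x) \<partial>M") auto
    ultimately show ?thesis
      using False by (simp add: ext_integral_def enn2ereal_ennreal)
  qed
qed

lemma dens_nonneg [simp]: "0 \<le> dens \<alpha> \<beta> x"
  by (simp add: dens_def)

lemma borel_measurable_dens [measurable]: "dens \<alpha> \<beta> \<in> borel_measurable \<beta>"
  unfolding dens_def by measurable

section \<open>Radon-Nikodym densities of finite measures\<close>

context
  fixes \<alpha> \<beta> :: "'a measure"
  assumes fin: "finite_measure \<alpha>" "finite_measure \<beta>"
    and sets_eq: "sets \<alpha> = sets \<beta>" and ac: "absolutely_continuous \<beta> \<alpha>"
begin

interpretation \<alpha>: finite_measure \<alpha> by (rule fin)
interpretation \<beta>: finite_measure \<beta> by (rule fin)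

text \<open>The derivative is finite almost everywhere because \<alpha> is sigma-finite, so passing
  to real values changes it only on a null set.\<close>

lemma density_dens: "density \<beta> (\<lambda>x. ennreal (dens \<alpha> \<beta> x)) = \<alpha>"
proof -
  have "AE x in \<beta>. RN_deriv \<beta> \<alpha> x \<noteq> \<infinity>"
    using ac sets_eq \<alpha>.sigma_finite_measure_axioms by (intro \<beta>.RN_deriv_finite) auto
  then have "density \<beta> (\<lambda>x. ennreal (dens \<alpha> \<beta> x)) = density \<beta> (RN_deriv \<beta> \<alpha>)"
    by (intro density_cong) (auto simp: dens_def ennreal_enn2real_if)
  also have "\<dots> = \<alpha>" using ac sets_eq by (rule \<beta>.density_RN_deriv)
  finally show ?thesis .
qed

lemma integrable_dens: "integrable \<beta> (dens \<alpha> \<beta>)"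
proof (rule integrableI_nonneg)
  have "(\<integral>\<^sup>+x. ennreal (dens \<alpha> \<beta> x) \<partial>\<beta>) = emeasure (density \<beta> (\<lambda>x. ennreal (dens \<alpha> \<beta> x))) (space \<beta>)"
    by (subst emeasure_density) (auto intro!: nn_integral_cong)
  also have "\<dots> < \<infinity>" by (simp only: density_dens) (simp add: \<alpha>.emeasure_eq_measure)
  finally show "(\<integral>\<^sup>+x. ennreal (dens \<alpha> \<beta> x) \<partial>\<beta>) < \<infinity>" .
qed auto

lemma integral_dens:
  fixes f :: "'a \<Rightarrow> real"
  assumes "f \<in> borel_measurable \<beta>"
  shows "(\<integral>x. f x \<partial>\<alpha>) = (\<integral>x. dens \<alpha> \<beta> x * f x \<partial>\<beta>)"
proof -
  have "(\<integral>x. f x \<partial>\<alpha>) = (\<integral>x. f x \<partial>density \<beta> (\<lambda>x. ennreal (dens \<alpha> \<beta> x)))"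
    by (simp add: density_dens)
  also have "\<dots> = (\<integral>x. dens \<alpha> \<beta> x * f x \<partial>\<beta>)"
    using assms by (subst integral_density) auto
  finally show ?thesis .
qed

text \<open>Makes \<open>dens\<close> computable from an explicit density; applied below to the
  Gibbs measure and to both of its marginals.\<close>

lemma dens_unique:
  assumes "f \<in> borel_measurable \<beta>" and "\<And>x. f x \<ge> 0"
    and "\<alpha> = density \<beta> (\<lambda>x. ennreal (f x))"
  shows "AE x in \<beta>. dens \<alpha> \<beta> x = f x"
proof -
  have "density \<beta> (\<lambda>x. ennreal (dens \<alpha> \<beta> x)) = density \<beta> (\<lambda>x. ennreal (f x))"
    using density_dens assms(3) by simp
  then have "AE x in \<beta>. ennreal (dens \<alpha> \<beta> x) = ennreal (f x)"
    using assms(1) by (intro \<beta>.density_unique_iff[THEN iffD1]) auto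
  then show ?thesis using assms(2) by simp
qed

text \<open>The summand 1 lifts the entropy integrand to a nonnegative one, hence the bound
  \<open>K = 0\<close>; \<open>shannon_eq\<close> has to use \<open>K = 1\<close>.\<close>

lemma KL_eq:
  "KL \<alpha> \<beta> = (if integrable \<beta> (\<lambda>x. dens \<alpha> \<beta> x * (ln (dens \<alpha> \<beta> x) - 1) + 1)
     then ereal (\<integral>x. dens \<alpha> \<beta> x * (ln (dens \<alpha> \<beta> x) - 1) + 1 \<partial>\<beta>) else \<infinity>)"
  unfolding KL_def if_P[OF ac]
proof (rule ext_integral_bounded_below[where K = 0])
  show "- 0 \<le> dens \<alpha> \<beta> x * (ln (dens \<alpha> \<beta> x) - 1) + 1" for x
    using entropy_ge_neg_one[OF dens_nonneg, of \<alpha> \<beta> x] by simp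
qed (use fin in measurable)

lemma shannon_eq:
  "shannon \<beta> \<alpha> = (if integrable \<beta> (\<lambda>x. dens \<alpha> \<beta> x * (ln (dens \<alpha> \<beta> x) - 1))
     then ereal (\<integral>x. dens \<alpha> \<beta> x * (ln (dens \<alpha> \<beta> x) - 1) \<partial>\<beta>) else \<infinity>)"
  using entropy_ge_neg_one[OF dens_nonneg, of \<alpha> \<beta>] ac fin(2)
  by (simp add: shannon_def ext_integral_bounded_below[where K = 1])

end

section \<open>Essentially bounded functions\<close>

lemma Linf_borel_measurable: "f \<in> Linf M \<Longrightarrow> f \<in> borel_measurable M"
  by (simp add: Linf_def)

lemma Linf_obtain_bound:
  assumes "f \<in> Linf M"
  obtains K where "K \<ge> 0" "AE x in M. \<bar>f x\<bar> \<le> K"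
proof -
  obtain K where "AE x in M. \<bar>f x\<bar> \<le> K" using assms by (auto simp: Linf_def)
  then have "AE x in M. \<bar>f x\<bar> \<le> max 0 K" by eventually_elim simp
  then show ?thesis by (intro that[of "max 0 K"]) auto
qed

lemma LinfI:
  "f \<in> borel_measurable M \<Longrightarrow> AE x in M. \<bar>f x\<bar> \<le> K \<Longrightarrow> f \<in> Linf M"
  by (auto simp: Linf_def)

lemma Linf_add:
  assumes "f \<in> Linf M" "g \<in> Linf M"
  shows "(\<lambda>x. f x + g x) \<in> Linf M"
proof -
  obtain K L where "AE x in M. \<bar>f x\<bar> \<le> K" "AE x in M. \<bar>g x\<bar> \<le> L"
    using assms by (auto simp: Linf_def)
  then have "AE x in M. \<bar>f x + g x\<bar> \<le> K + L" by eventually_elim auto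
  then show ?thesis
    using assms by (intro LinfI[where K = "K + L"]) (auto simp: Linf_def)
qed

lemma Linf_cmult:
  assumes "f \<in> Linf M"
  shows "(\<lambda>x. a * f x) \<in> Linf M"
proof -
  obtain K where "AE x in M. \<bar>f x\<bar> \<le> K"
    using assms by (auto simp: Linf_def)
  then have "AE x in M. \<bar>a * f x\<bar> \<le> \<bar>a\<bar> * K"
    by eventually_elim (simp add: abs_mult mult_left_mono)
  then show ?thesis
    using assms by (intro LinfI[where K = "\<bar>a\<bar> * K"]) (auto simp: Linf_def)
qed

lemma Linf_uminus: "f \<in> Linf M \<Longrightarrow> (\<lambda>x. - f x) \<in> Linf M"
  using Linf_cmult[of f M "- 1"] by simp

lemma Linf_diff: "f \<in> Linf M \<Longrightarrow> g \<in> Linf M \<Longrightarrow> (\<lambda>x. f x - g x) \<in> Linf M"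
  using Linf_add[of f M "\<lambda>x. - g x"] Linf_uminus[of g M] by simp

lemma Linf_divide: "f \<in> Linf M \<Longrightarrow> (\<lambda>x. f x / a) \<in> Linf M"
  using Linf_cmult[of f M "inverse a"] by (simp add: field_simps)

lemma Linf_exp:
  assumes "f \<in> Linf M"
  shows "(\<lambda>x. exp (f x)) \<in> Linf M"
proof -
  obtain K where "AE x in M. \<bar>f x\<bar> \<le> K"
    using assms by (auto simp: Linf_def)
  then have "AE x in M. \<bar>exp (f x)\<bar> \<le> exp K"
    by eventually_elim simp
  then show ?thesis
    using assms by (intro LinfI[where K = "exp K"]) (auto simp: Linf_def)
qed

text \<open>Domination by \<open>K * g\<close>. With a density as \<open>g\<close>, this makes
  potentials and the cost integrable against plans whose density may be unbounded.\<close>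

lemma integrable_mult_Linf:
  fixes f g :: "'a \<Rightarrow> real"
  assumes "integrable M g" "f \<in> Linf M"
  shows "integrable M (\<lambda>x. g x * f x)"
proof -
  obtain K where K: "K \<ge> 0" "AE x in M. \<bar>f x\<bar> \<le> K" using assms(2) by (rule Linf_obtain_bound)
  show ?thesis
  proof (rule Bochner_Integration.integrable_bound)
    show "integrable M (\<lambda>x. K * g x)" using assms(1) by simp
    show "AE x in M. norm (g x * f x) \<le> norm (K * g x)"
      using K(2)
    proof eventually_elim
      case (elim x)
      then have "\<bar>g x\<bar> * \<bar>f x\<bar> \<le> \<bar>g x\<bar> * K" by (intro mult_left_mono) auto
      then show ?case using K(1) by (simp add: abs_mult mult.commute)
    qed
    show "(\<lambda>x. g x * f x) \<in> borel_measurable M"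
      using assms by (auto simp: Linf_def)
  qed
qed

lemma (in finite_measure) integrable_Linf:
  "f \<in> Linf M \<Longrightarrow> integrable M f"
  using integrable_mult_Linf[of M "\<lambda>_. 1" f] by simp

text \<open>For \<open>f = exp w\<close> the entropy integrand is \<open>exp w * (w - 1)\<close>,
  which is essentially bounded, and Fenchel-Young is an equality. Used to make all three gaps of the
  Gibbs measure vanish.\<close>

lemma integrable_entropy_exp:
  assumes "finite_measure M" and w: "w \<in> Linf M"
    and [measurable]: "f \<in> borel_measurable M" and "AE x in M. f x = exp (w x)"
  shows "integrable M (\<lambda>x. f x * (ln (f x) - 1))" "(\<integral>x. kl_gap (f x) (w x) \<partial>M) = 0"
proof -
  interpret finite_measure M by fact
  have [measurable]: "w \<in> borel_measurable M" using w by (rule Linf_borel_measurable)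
  have "(\<lambda>x. w x - 1) \<in> Linf M"
    using w by (intro Linf_diff) (auto intro!: LinfI[where K = 1])
  then have "integrable M (\<lambda>x. exp (w x) * (w x - 1))"
    using w by (intro integrable_mult_Linf integrable_Linf Linf_exp)
  moreover have "AE x in M. exp (w x) * (w x - 1) = f x * (ln (f x) - 1)"
    using assms(4) by eventually_elim simp
  ultimately show "integrable M (\<lambda>x. f x * (ln (f x) - 1))"
    by (subst integrable_cong_AE[symmetric]) auto
  have "AE x in M. kl_gap (f x) (w x) = 0"
    using assms(4) by eventually_elim (simp add: kl_gap_eq_0_iff)
  then show "(\<integral>x. kl_gap (f x) (w x) \<partial>M) = 0"
    by (rule integral_eq_zero_AE)
qed

text \<open>Fenchel-Young with its remainder, integrated: the cross term, density times
  \<open>w\<close>, becomes the integral of \<open>w\<close> against \<alpha>. The terms may be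
  split because boundedness of \<open>w\<close> makes each of them integrable.\<close>

lemma entropy_gap:
  assumes fin: "finite_measure \<alpha>" "finite_measure \<beta>" and se: "sets \<alpha> = sets \<beta>"
    and ac: "absolutely_continuous \<beta> \<alpha>"
    and w: "w \<in> Linf \<beta>"
    and int: "integrable \<beta> (\<lambda>x. dens \<alpha> \<beta> x * (ln (dens \<alpha> \<beta> x) - 1))"
  shows "integrable \<beta> (\<lambda>x. kl_gap (dens \<alpha> \<beta> x) (w x))"
    and "(\<integral>x. dens \<alpha> \<beta> x * (ln (dens \<alpha> \<beta> x) - 1) \<partial>\<beta>) =
      (\<integral>x. kl_gap (dens \<alpha> \<beta> x) (w x) \<partial>\<beta>) + (\<integral>x. w x \<partial>\<alpha>) - (\<integral>x. exp (w x) \<partial>\<beta>)"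
proof -
  interpret \<beta>: finite_measure \<beta> by (rule fin)
  have 1: "integrable \<beta> (\<lambda>x. dens \<alpha> \<beta> x * w x)"
    using integrable_dens[OF fin se ac] w by (rule integrable_mult_Linf)
  have 2: "integrable \<beta> (\<lambda>x. exp (w x))"
    using w by (intro \<beta>.integrable_Linf Linf_exp)
  have eq: "kl_gap (dens \<alpha> \<beta> x) (w x) =
      dens \<alpha> \<beta> x * (ln (dens \<alpha> \<beta> x) - 1) - dens \<alpha> \<beta> x * w x + exp (w x)" for x
    by (simp add: kl_gap_def algebra_simps)
  show "integrable \<beta> (\<lambda>x. kl_gap (dens \<alpha> \<beta> x) (w x))"
    unfolding eq using 1 2 int by auto
  show "(\<integral>x. dens \<alpha> \<beta> x * (ln (dens \<alpha> \<beta> x) - 1) \<partial>\<beta>) =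
      (\<integral>x. kl_gap (dens \<alpha> \<beta> x) (w x) \<partial>\<beta>) + (\<integral>x. w x \<partial>\<alpha>) - (\<integral>x. exp (w x) \<partial>\<beta>)"
    unfolding eq using 1 2 int integral_dens[OF fin se ac Linf_borel_measurable[OF w]] by simp
qed

section \<open>Pointwise optimality of the transform\<close>

text \<open>The prefactor is the inverse of 1/\<tau> + 1/\<epsilon>, so \<open>T\<close> solves ln J
  + T/\<epsilon> = -T/\<tau>. Exponentiated, this is the first-order condition for maximizing
  -\<tau> exp(-t/\<tau>) - \<epsilon> J exp(t/\<epsilon>) over t.\<close>

lemma transform_log_identity:
  fixes J T \<epsilon> \<tau> :: real
  assumes "J > 0" "\<epsilon> > 0" "\<tau> > 0" and "T = - (\<tau> * \<epsilon> / (\<tau> + \<epsilon>)) * ln J"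
  shows "J * exp (T / \<epsilon>) = exp (- T / \<tau>)"
proof -
  have "\<tau> + \<epsilon> \<noteq> 0" using assms by simp
  then have "ln J + T / \<epsilon> = - T / \<tau>"
    using assms(2,3) unfolding assms(4) by (simp add: divide_simps) algebra
  then have "exp (ln J + T / \<epsilon>) = exp (- T / \<tau>)" by simp
  then show ?thesis using assms(1) by (simp add: exp_add)
qed

lemma exp_gt_add_one:
  fixes x :: real
  assumes "x \<noteq> 0"
  shows "1 + x < exp x"
proof (rule ccontr)
  assume "\<not> ?thesis"
  then have "exp x = 1 + x" using exp_ge_add_one_self[of x] by linarith
  then have "ln (exp x) = exp x - 1" using ln_exp[of x] by linarith
  then have "exp x = 1" by (intro ln_eq_minus_one) auto
  with assms show False by simp
qed

text \<open>\<open>gain\<close> is f(T) - f(t) for the strictly concave f(t) = -\<tau>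
  exp(-t/\<tau>) - \<epsilon> J exp(t/\<epsilon>), and the hypothesis on \<open>T\<close> says that
  f'(T) = 0.\<close>

lemma transform_strict_optimality:
  fixes J T t \<epsilon> \<tau> :: real
  assumes "\<epsilon> > 0" "\<tau> > 0" and T: "J * exp (T / \<epsilon>) = exp (- T / \<tau>)"
  defines "gain \<equiv> \<tau> * (exp (- t / \<tau>) - exp (- T / \<tau>)) + \<epsilon> * (exp (t / \<epsilon>) * J - exp (T / \<epsilon>) * J)"
  shows "gain \<ge> 0" and "gain = 0 \<Longrightarrow> T = t"
proof -
  \<comment> \<open>$\mathrm{gain} = s\,[\tau(e^{d/\tau} - 1) + \varepsilon(e^{-d/\varepsilon} - 1)] \ge s (d - d)$ with
    $d = T - t$\<close>
  define s where "s = exp (- T / \<tau>)"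
  have 1: "exp (- t / \<tau>) = s * exp ((T - t) / \<tau>)"
    by (simp add: s_def diff_divide_distrib flip: exp_add)
  \<comment> \<open>The first-order condition eliminates \<open>J\<close>, which equals s
    exp(-T/\<epsilon>).\<close>
  have 2: "exp (t / \<epsilon>) * J = s * exp ((t - T) / \<epsilon>)"
    using T by (simp add: s_def diff_divide_distrib exp_diff field_simps)
  have gain: "gain = s * (\<tau> * (exp ((T - t) / \<tau>) - 1) + \<epsilon> * (exp ((t - T) / \<epsilon>) - 1))"
    unfolding gain_def 1 2 using T by (simp add: s_def algebra_simps)
  have "T - t \<le> \<tau> * (exp ((T - t) / \<tau>) - 1)"
    using exp_ge_add_one_self[of "(T - t) / \<tau>"] assms(2) by (simp add: field_simps)
  moreover have "t - T \<le> \<epsilon> * (exp ((t - T) / \<epsilon>) - 1)"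
    using exp_ge_add_one_self[of "(t - T) / \<epsilon>"] assms(1) by (simp add: field_simps)
  ultimately have ge: "\<tau> * (exp ((T - t) / \<tau>) - 1) + \<epsilon> * (exp ((t - T) / \<epsilon>) - 1) \<ge> 0" by linarith
  then show "gain \<ge> 0" unfolding gain by (simp add: s_def)
  show "T = t" if "gain = 0"
  proof (rule ccontr)
    assume "T \<noteq> t"
    \<comment> \<open>One strict tangent bound is enough: the linear parts T - t and t - T cancel,
      so the sum of the two terms is positive.\<close>
    then have "T - t < \<tau> * (exp ((T - t) / \<tau>) - 1)"
      using exp_gt_add_one[of "(T - t) / \<tau>"] assms(2) by (simp add: field_simps)
    moreover note \<open>t - T \<le> \<epsilon> * (exp ((t - T) / \<epsilon>) - 1)\<close>
    moreover have "\<tau> * (exp ((T - t) / \<tau>) - 1) + \<epsilon> * (exp ((t - T) / \<epsilon>) - 1) = 0"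
      using that unfolding gain by (simp add: s_def)
    ultimately show False by linarith
  qed
qed

section \<open>Duality gap\<close>

text \<open>Tonelli on the strip over \<open>A\<close>, where the indicator does not depend on the
  first variable and leaves the inner integral. The target \<open>N\<close> is separate from
  \<open>M2\<close> because \<open>primal\<close> pushes plans forward to
  \<open>borel\<close>.\<close>

lemma (in pair_sigma_finite) distr_density_snd:
  assumes [measurable]: "f \<in> borel_measurable (M1 \<Otimes>\<^sub>M M2)" and "sets N = sets M2"
  shows "distr (density (M1 \<Otimes>\<^sub>M M2) f) N snd = density M2 (\<lambda>y. \<integral>\<^sup>+x. f (x, y) \<partial>M1)"
proof (rule measure_eqI)
  have [measurable]: "snd \<in> density (M1 \<Otimes>\<^sub>M M2) f \<rightarrow>\<^sub>M N"
    using assms(2) by (simp cong: measurable_cong_sets)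
  fix A assume "A \<in> sets (distr (density (M1 \<Otimes>\<^sub>M M2) f) N snd)"
  then have [measurable]: "A \<in> sets N" "A \<in> sets M2" using assms(2) by auto
  have "emeasure (distr (density (M1 \<Otimes>\<^sub>M M2) f) N snd) A =
      (\<integral>\<^sup>+z. f z * indicator A (snd z) \<partial>(M1 \<Otimes>\<^sub>M M2))"
    by (subst emeasure_distr)
       (auto simp: emeasure_density space_pair_measure split: split_indicator intro!: nn_integral_cong)
  also have "\<dots> = (\<integral>\<^sup>+y. \<integral>\<^sup>+x. f (x, y) * indicator A y \<partial>M1 \<partial>M2)"
    by (subst nn_integral_snd[symmetric]) (auto simp: split_beta')
  also have "\<dots> = (\<integral>\<^sup>+y. (\<integral>\<^sup>+x. f (x, y) \<partial>M1) * indicator A y \<partial>M2)"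
    by (intro nn_integral_cong nn_integral_multc) auto
  also have "\<dots> = emeasure (density M2 (\<lambda>y. \<integral>\<^sup>+x. f (x, y) \<partial>M1)) A"
    by (subst emeasure_density) auto
  finally show "emeasure (distr (density (M1 \<Otimes>\<^sub>M M2) f) N snd) A = \<dots>" .
qed (use assms in simp)

lemma (in pair_sigma_finite) distr_density_fst:
  assumes [measurable]: "f \<in> borel_measurable (M1 \<Otimes>\<^sub>M M2)" and "sets N = sets M1"
  shows "distr (density (M1 \<Otimes>\<^sub>M M2) f) N fst = density M1 (\<lambda>x. \<integral>\<^sup>+y. f (x, y) \<partial>M2)"
proof (rule measure_eqI)
  have [measurable]: "fst \<in> density (M1 \<Otimes>\<^sub>M M2) f \<rightarrow>\<^sub>M N"
    using assms(2) by (simp cong: measurable_cong_sets)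
  fix A assume "A \<in> sets (distr (density (M1 \<Otimes>\<^sub>M M2) f) N fst)"
  then have [measurable]: "A \<in> sets N" "A \<in> sets M1" using assms(2) by auto
  have "emeasure (distr (density (M1 \<Otimes>\<^sub>M M2) f) N fst) A =
      (\<integral>\<^sup>+z. f z * indicator A (fst z) \<partial>(M1 \<Otimes>\<^sub>M M2))"
    by (subst emeasure_distr)
       (auto simp: emeasure_density space_pair_measure split: split_indicator intro!: nn_integral_cong)
  also have "\<dots> = (\<integral>\<^sup>+x. \<integral>\<^sup>+y. f (x, y) * indicator A x \<partial>M2 \<partial>M1)"
    by (subst M2.nn_integral_fst[symmetric]) auto
  also have "\<dots> = (\<integral>\<^sup>+x. (\<integral>\<^sup>+y. f (x, y) \<partial>M2) * indicator A x \<partial>M1)"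
    by (intro nn_integral_cong nn_integral_multc) auto
  also have "\<dots> = emeasure (density M1 (\<lambda>x. \<integral>\<^sup>+y. f (x, y) \<partial>M2)) A"
    by (subst emeasure_density) auto
  finally show "emeasure (distr (density (M1 \<Otimes>\<^sub>M M2) f) N fst) A = \<dots>" .
qed (use assms in simp)

text \<open>The assumptions are symmetric in the two factors, so the locale can be instantiated
  again with the factors exchanged. Second countability identifies the product of the Borel algebras
  with the Borel algebra of the product.\<close>

locale entropic_uot = M1: finite_measure \<mu> + M2: finite_measure \<nu>
  for \<mu> :: "'a::second_countable_topology measure" and \<nu> :: "'b::second_countable_topology measure" +
  fixes c :: "'a \<times> 'b \<Rightarrow> real" and \<epsilon> \<tau>\<^sub>1 \<tau>\<^sub>2 :: real
  assumes pos: "\<epsilon> > 0" "\<tau>\<^sub>1 > 0" "\<tau>\<^sub>2 > 0"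
    and sets_\<mu>: "sets \<mu> = sets borel" and sets_\<nu>: "sets \<nu> = sets borel"
    and \<mu>_pos: "emeasure \<mu> UNIV > 0" and \<nu>_pos: "emeasure \<nu> UNIV > 0"
    and c_Linf: "c \<in> Linf (\<mu> \<Otimes>\<^sub>M \<nu>)"
begin

sublocale P: pair_sigma_finite \<mu> \<nu> ..

abbreviation \<pi> :: "('a \<times> 'b) measure" where "\<pi> \<equiv> \<mu> \<Otimes>\<^sub>M \<nu>"

sublocale \<pi>: finite_measure \<pi>
  using M2.finite_measure_axioms M1.finite_measure_axioms by (rule finite_measure_pair_measure)

abbreviation D where "D \<equiv> dual \<mu> \<nu> c \<epsilon> \<tau>\<^sub>1 \<tau>\<^sub>2"
abbreviation primal_cost where "primal_cost \<equiv> primal \<mu> \<nu> c \<epsilon> \<tau>\<^sub>1 \<tau>\<^sub>2"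

definition log_gibbs :: "('a \<Rightarrow> real) \<Rightarrow> ('b \<Rightarrow> real) \<Rightarrow> 'a \<times> 'b \<Rightarrow> real" where
  "log_gibbs u v z = (u (fst z) + v (snd z) - c z) / \<epsilon>"

lemma sets_\<pi>: "sets \<pi> = sets borel"
proof -
  have "sets \<pi> = sets ((borel :: 'a measure) \<Otimes>\<^sub>M (borel :: 'b measure))"
    using sets_\<mu> sets_\<nu> by (rule sets_pair_measure_cong)
  then show ?thesis by (simp only: borel_prod)
qed

lemma c_measurable [measurable]: "c \<in> borel_measurable \<pi>"
  using c_Linf by (rule Linf_borel_measurable)

lemma Linf_fst:
  assumes "u \<in> Linf \<mu>"
  shows "(\<lambda>z. u (fst z)) \<in> Linf \<pi>"
proof -
  have [measurable]: "u \<in> borel_measurable \<mu>" using assms by (rule Linf_borel_measurable)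
  obtain K where K: "AE x in \<mu>. \<bar>u x\<bar> \<le> K" using assms by (auto simp: Linf_def)
  have "AE z in \<pi>. \<bar>u (fst z)\<bar> \<le> K"
  proof (rule P.AE_pair_measure)
    show "AE x in \<mu>. AE y in \<nu>. \<bar>u (fst (x, y))\<bar> \<le> K" using K by eventually_elim simp
  qed measurable
  then show ?thesis by (intro LinfI) auto
qed

lemma Linf_snd:
  assumes "v \<in> Linf \<nu>"
  shows "(\<lambda>z. v (snd z)) \<in> Linf \<pi>"
proof -
  have [measurable]: "v \<in> borel_measurable \<nu>" using assms by (rule Linf_borel_measurable)
  obtain K where K: "AE y in \<nu>. \<bar>v y\<bar> \<le> K" using assms by (auto simp: Linf_def)
  have "AE z in \<pi>. \<bar>v (snd z)\<bar> \<le> K"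
  proof (rule P.AE_pair_measure)
    show "AE x in \<mu>. AE y in \<nu>. \<bar>v (snd (x, y))\<bar> \<le> K" using K by simp
  qed measurable
  then show ?thesis by (intro LinfI) auto
qed

lemma log_gibbs_Linf:
  assumes "u \<in> Linf \<mu>" "v \<in> Linf \<nu>"
  shows "log_gibbs u v \<in> Linf \<pi>"
  using Linf_divide[OF Linf_diff[OF Linf_add[OF Linf_fst[OF assms(1)] Linf_snd[OF assms(2)]] c_Linf], of \<epsilon>]
  by (simp add: log_gibbs_def[abs_def])

lemma gibbs_eq: "gibbs \<mu> \<nu> c \<epsilon> u v = density \<pi> (\<lambda>z. ennreal (exp (log_gibbs u v z)))"
  by (simp add: gibbs_def log_gibbs_def split_beta')

text \<open>The constants are integrated into total masses, which later match the masses coming from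
  the summand 1 in \<open>KL\<close>.\<close>

lemma dual_eq:
  assumes "u \<in> Linf \<mu>" "v \<in> Linf \<nu>"
  shows "D u v = - \<tau>\<^sub>1 * ((\<integral>x. exp (- u x / \<tau>\<^sub>1) \<partial>\<mu>) - measure \<mu> (space \<mu>))
    - \<tau>\<^sub>2 * ((\<integral>y. exp (- v y / \<tau>\<^sub>2) \<partial>\<nu>) - measure \<nu> (space \<nu>))
    - \<epsilon> * (\<integral>z. exp (log_gibbs u v z) \<partial>\<pi>)"
proof -
  have "integrable \<mu> (\<lambda>x. exp (- u x / \<tau>\<^sub>1))" "integrable \<nu> (\<lambda>y. exp (- v y / \<tau>\<^sub>2))"
    using assms by (auto intro!: M1.integrable_Linf M2.integrable_Linf Linf_exp Linf_divide Linf_uminus)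
  then show ?thesis by (simp add: dual_def log_gibbs_def split_beta')
qed

section \<open>Plans absolutely continuous with respect to the product measure\<close>

context
  fixes \<gamma> assumes \<gamma>: "\<gamma> \<in> pos_measures" and ac: "absolutely_continuous \<pi> \<gamma>"
begin

interpretation \<gamma>: finite_measure \<gamma> using \<gamma> by (simp add: pos_measures_def)

lemma sets_plan: "sets \<gamma> = sets \<pi>"
  using \<gamma> sets_\<pi> by (simp add: pos_measures_def)

lemma measurable_fst_plan: "fst \<in> \<gamma> \<rightarrow>\<^sub>M borel" "fst \<in> \<gamma> \<rightarrow>\<^sub>M \<mu>"
  using measurable_fst[of \<mu> \<nu>] sets_plan sets_\<mu> by (auto cong: measurable_cong_sets)

lemma measurable_snd_plan: "snd \<in> \<gamma> \<rightarrow>\<^sub>M borel" "snd \<in> \<gamma> \<rightarrow>\<^sub>M \<nu>"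
  using measurable_snd[of \<mu> \<nu>] sets_plan sets_\<nu> by (auto cong: measurable_cong_sets)

lemma finite_marginals:
  "finite_measure (distr \<gamma> borel fst)" "finite_measure (distr \<gamma> borel snd)"
  using measurable_fst_plan(1) measurable_snd_plan(1) by (auto intro: \<gamma>.finite_measure_distr)

lemma sets_marginals: "sets (distr \<gamma> borel fst) = sets \<mu>" "sets (distr \<gamma> borel snd) = sets \<nu>"
  using sets_\<mu> sets_\<nu> by auto

lemma space_plan: "space \<gamma> = UNIV"
  using \<gamma> by (auto simp: pos_measures_def dest: sets_eq_imp_space_eq)

text \<open>The preimage of a null set under a projection is a cylinder, null for the product
  measure and therefore for \<gamma>.\<close>

lemma ac_marginals:
  "absolutely_continuous \<mu> (distr \<gamma> borel fst)" "absolutely_continuous \<nu> (distr \<gamma> borel snd)"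
proof -
  have space: "space \<mu> = UNIV" "space \<nu> = UNIV"
    using sets_\<mu> sets_\<nu> by (auto dest: sets_eq_imp_space_eq)
  show "absolutely_continuous \<mu> (distr \<gamma> borel fst)"
    unfolding absolutely_continuous_def
  proof
    fix A assume A: "A \<in> null_sets \<mu>"
    then have "A \<times> UNIV \<in> null_sets \<pi>"
      using M2.emeasure_pair_measure_Times[of A \<mu> UNIV] sets.top[of \<nu>] space
      by (auto simp: null_sets_def)
    then have "A \<times> UNIV \<in> null_sets \<gamma>" using ac by (auto simp: absolutely_continuous_def)
    moreover have "fst -` A \<inter> space \<gamma> = A \<times> UNIV" by (auto simp: space_plan)
    ultimately show "A \<in> null_sets (distr \<gamma> borel fst)"
      using A measurable_fst_plan(1) sets_\<mu> by (auto simp: null_sets_def emeasure_distr)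
  qed
  show "absolutely_continuous \<nu> (distr \<gamma> borel snd)"
    unfolding absolutely_continuous_def
  proof
    fix A assume A: "A \<in> null_sets \<nu>"
    then have "UNIV \<times> A \<in> null_sets \<pi>"
      using M2.emeasure_pair_measure_Times[of UNIV \<mu> A] sets.top[of \<mu>] space
      by (auto simp: null_sets_def)
    then have "UNIV \<times> A \<in> null_sets \<gamma>" using ac by (auto simp: absolutely_continuous_def)
    moreover have "snd -` A \<inter> space \<gamma> = UNIV \<times> A" by (auto simp: space_plan)
    ultimately show "A \<in> null_sets (distr \<gamma> borel snd)"
      using A measurable_snd_plan(1) sets_\<nu> by (auto simp: null_sets_def emeasure_distr)
  qed
qed

text \<open>Rewrites the linear term on the product through the marginals, so that it can cancel the
  transport cost and the linear terms of the two marginal entropies. Bounded functions are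
  \<gamma>-integrable because \<gamma> has an integrable density.\<close>

lemma integral_log_gibbs:
  assumes u: "u \<in> Linf \<mu>" and v: "v \<in> Linf \<nu>"
  shows "\<epsilon> * (\<integral>z. log_gibbs u v z \<partial>\<gamma>) =
    (\<integral>x. u x \<partial>distr \<gamma> borel fst) + (\<integral>y. v y \<partial>distr \<gamma> borel snd) - (\<integral>z. c z \<partial>\<gamma>)"
proof -
  have fin: "finite_measure \<gamma>" "finite_measure \<pi>" by unfold_locales
  have int: "integrable \<gamma> f" if f: "f \<in> Linf \<pi>" for f
  proof -
    have "integrable \<pi> (\<lambda>z. dens \<gamma> \<pi> z * f z)"
      using integrable_dens[OF fin sets_plan ac] f by (rule integrable_mult_Linf)
    then have "integrable (density \<pi> (\<lambda>z. ennreal (dens \<gamma> \<pi> z))) f"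
      using Linf_borel_measurable[OF f] by (subst integrable_density) auto
    then show ?thesis by (simp add: density_dens[OF fin sets_plan ac])
  qed
  have "u \<in> borel_measurable borel" "v \<in> borel_measurable borel"
    using Linf_borel_measurable[OF u] Linf_borel_measurable[OF v] sets_\<mu> sets_\<nu>
    by (auto cong: measurable_cong_sets)
  then have "(\<integral>x. u x \<partial>distr \<gamma> borel fst) = (\<integral>z. u (fst z) \<partial>\<gamma>)"
      "(\<integral>y. v y \<partial>distr \<gamma> borel snd) = (\<integral>z. v (snd z) \<partial>\<gamma>)"
    using measurable_fst_plan(1) measurable_snd_plan(1) by (auto intro!: integral_distr)
  then show ?thesis
    using pos int[OF Linf_fst[OF u]] int[OF Linf_snd[OF v]] int[OF c_Linf]
    by (simp add: log_gibbs_def)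
qed

text \<open>\<open>entropy_gap\<close> is applied three times, with \<open>log_gibbs u v\<close> and
  with the potentials divided by the negative marginal weights. All linear terms cancel by
  \<open>integral_log_gibbs\<close>; the exponentials and masses left over form the dual
  value.\<close>

lemma primal_eq_dual_plus_gap:
  assumes u: "u \<in> Linf \<mu>" and v: "v \<in> Linf \<nu>"
  defines "\<alpha> \<equiv> dens (distr \<gamma> borel fst) \<mu>" and "\<beta> \<equiv> dens (distr \<gamma> borel snd) \<nu>"
  assumes int: "integrable \<pi> (\<lambda>z. dens \<gamma> \<pi> z * (ln (dens \<gamma> \<pi> z) - 1))"
    "integrable \<mu> (\<lambda>x. \<alpha> x * (ln (\<alpha> x) - 1))" "integrable \<nu> (\<lambda>y. \<beta> y * (ln (\<beta> y) - 1))"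
  shows "primal_cost \<gamma> = ereal (D u v + \<epsilon> * (\<integral>z. kl_gap (dens \<gamma> \<pi> z) (log_gibbs u v z) \<partial>\<pi>)
    + \<tau>\<^sub>1 * (\<integral>x. kl_gap (\<alpha> x) (- u x / \<tau>\<^sub>1) \<partial>\<mu>) + \<tau>\<^sub>2 * (\<integral>y. kl_gap (\<beta> y) (- v y / \<tau>\<^sub>2) \<partial>\<nu>))"
proof -
  have fin: "finite_measure \<gamma>" "finite_measure \<pi>" "finite_measure \<mu>" "finite_measure \<nu>"
    by unfold_locales
  note facts\<pi> = fin(1,2) sets_plan ac
  note facts\<mu> = finite_marginals(1) fin(3) sets_marginals(1) ac_marginals(1)
  note facts\<nu> = finite_marginals(2) fin(4) sets_marginals(2) ac_marginals(2)
  have u': "(\<lambda>x. - u x / \<tau>\<^sub>1) \<in> Linf \<mu>" and v': "(\<lambda>y. - v y / \<tau>\<^sub>2) \<in> Linf \<nu>"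
    using u v by (auto intro!: Linf_divide Linf_uminus)
  have "primal_cost \<gamma> = ereal ((\<integral>z. c z \<partial>\<gamma>)
      + \<epsilon> * (\<integral>z. dens \<gamma> \<pi> z * (ln (dens \<gamma> \<pi> z) - 1) \<partial>\<pi>)
      + \<tau>\<^sub>1 * ((\<integral>x. \<alpha> x * (ln (\<alpha> x) - 1) \<partial>\<mu>) + measure \<mu> (space \<mu>))
      + \<tau>\<^sub>2 * ((\<integral>y. \<beta> y * (ln (\<beta> y) - 1) \<partial>\<nu>) + measure \<nu> (space \<nu>)))"
    using int ac unfolding primal_def \<alpha>_def \<beta>_def
    by (simp add: shannon_eq[OF facts\<pi>] KL_eq[OF facts\<mu>] KL_eq[OF facts\<nu>])
  also have "\<dots> = ereal (D u v + \<epsilon> * (\<integral>z. kl_gap (dens \<gamma> \<pi> z) (log_gibbs u v z) \<partial>\<pi>)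
    + \<tau>\<^sub>1 * (\<integral>x. kl_gap (\<alpha> x) (- u x / \<tau>\<^sub>1) \<partial>\<mu>) + \<tau>\<^sub>2 * (\<integral>y. kl_gap (\<beta> y) (- v y / \<tau>\<^sub>2) \<partial>\<nu>))"
    unfolding dual_eq[OF u v] entropy_gap(2)[OF facts\<pi> log_gibbs_Linf[OF u v] int(1)]
      entropy_gap(2)[OF facts\<mu> u' int(2)[unfolded \<alpha>_def], folded \<alpha>_def]
      entropy_gap(2)[OF facts\<nu> v' int(3)[unfolded \<beta>_def], folded \<beta>_def]
    using integral_log_gibbs[OF u v] pos by (simp add: algebra_simps)
  finally show ?thesis .
qed

text \<open>No entropy term can be minus infinity, so a finite sum forces each of them to be finite.
  The constant 1 inside \<open>KL\<close> is integrable and is subtracted again.\<close>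

lemma primal_finite_imp_integrable:
  assumes "primal_cost \<gamma> \<noteq> \<infinity>"
  defines "\<alpha> \<equiv> dens (distr \<gamma> borel fst) \<mu>" and "\<beta> \<equiv> dens (distr \<gamma> borel snd) \<nu>"
  shows "integrable \<pi> (\<lambda>z. dens \<gamma> \<pi> z * (ln (dens \<gamma> \<pi> z) - 1))"
    and "integrable \<mu> (\<lambda>x. \<alpha> x * (ln (\<alpha> x) - 1))" and "integrable \<nu> (\<lambda>y. \<beta> y * (ln (\<beta> y) - 1))"
proof -
  have fin: "finite_measure \<gamma>" "finite_measure \<pi>" "finite_measure \<mu>" "finite_measure \<nu>"
    by unfold_locales
  note facts\<pi> = fin(1,2) sets_plan ac
  note facts\<mu> = finite_marginals(1) fin(3) sets_marginals(1) ac_marginals(1)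
  note facts\<nu> = finite_marginals(2) fin(4) sets_marginals(2) ac_marginals(2)
  have *: "integrable \<pi> (\<lambda>z. dens \<gamma> \<pi> z * (ln (dens \<gamma> \<pi> z) - 1))
    \<and> integrable \<mu> (\<lambda>x. \<alpha> x * (ln (\<alpha> x) - 1) + 1) \<and> integrable \<nu> (\<lambda>y. \<beta> y * (ln (\<beta> y) - 1) + 1)"
    using assms(1) ac pos unfolding primal_def \<alpha>_def \<beta>_def
    by (auto simp: shannon_eq[OF facts\<pi>] KL_eq[OF facts\<mu>] KL_eq[OF facts\<nu>] split: if_splits)
  then show "integrable \<pi> (\<lambda>z. dens \<gamma> \<pi> z * (ln (dens \<gamma> \<pi> z) - 1))" by simp
  have "integrable \<mu> (\<lambda>x. (\<alpha> x * (ln (\<alpha> x) - 1) + 1) - 1)"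
    using * by (intro Bochner_Integration.integrable_diff M1.integrable_const) blast
  then show "integrable \<mu> (\<lambda>x. \<alpha> x * (ln (\<alpha> x) - 1))" by simp
  have "integrable \<nu> (\<lambda>y. (\<beta> y * (ln (\<beta> y) - 1) + 1) - 1)"
    using * by (intro Bochner_Integration.integrable_diff M2.integrable_const) blast
  then show "integrable \<nu> (\<lambda>y. \<beta> y * (ln (\<beta> y) - 1))" by simp
qed

end

section \<open>Weak duality and its equality case\<close>

lemma primal_decomposition:
  assumes "\<gamma> \<in> pos_measures" "primal_cost \<gamma> \<noteq> \<infinity>" "u \<in> Linf \<mu>" "v \<in> Linf \<nu>"
  shows "absolutely_continuous \<pi> \<gamma>"
    and "integrable \<pi> (\<lambda>z. kl_gap (dens \<gamma> \<pi> z) (log_gibbs u v z))"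
    and "ereal (D u v + \<epsilon> * (\<integral>z. kl_gap (dens \<gamma> \<pi> z) (log_gibbs u v z) \<partial>\<pi>)) \<le> primal_cost \<gamma>"
proof -
  show ac: "absolutely_continuous \<pi> \<gamma>" using assms(2) by (auto simp: primal_def split: if_splits)
  note int = primal_finite_imp_integrable[OF assms(1) ac assms(2)]
  have "finite_measure \<gamma>" using assms(1) by (simp add: pos_measures_def)
  then show "integrable \<pi> (\<lambda>z. kl_gap (dens \<gamma> \<pi> z) (log_gibbs u v z))"
    using \<pi>.finite_measure_axioms sets_plan[OF assms(1) ac] ac log_gibbs_Linf[OF assms(3,4)] int(1)
    by (rule entropy_gap(1))
  \<comment> \<open>The two marginal gaps are dropped by nonnegativity; the gap on the product alone
    suffices to recover the plan in the equality case.\<close>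
  show "ereal (D u v + \<epsilon> * (\<integral>z. kl_gap (dens \<gamma> \<pi> z) (log_gibbs u v z) \<partial>\<pi>)) \<le> primal_cost \<gamma>"
    unfolding primal_eq_dual_plus_gap[OF assms(1) ac assms(3,4) int] using pos
    by (simp add: kl_gap_nonneg add_nonneg_nonneg)
qed

lemma weak_duality:
  assumes "\<gamma> \<in> pos_measures" "u \<in> Linf \<mu>" "v \<in> Linf \<nu>"
  shows "ereal (D u v) \<le> primal_cost \<gamma>"
proof (cases "primal_cost \<gamma> = \<infinity>")
  case False
  have "ereal (D u v) \<le> ereal (D u v + \<epsilon> * (\<integral>z. kl_gap (dens \<gamma> \<pi> z) (log_gibbs u v z) \<partial>\<pi>))"
    using pos by (simp add: kl_gap_nonneg)
  also have "\<dots> \<le> primal_cost \<gamma>" by (rule primal_decomposition[OF assms(1) False assms(2,3)])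
  finally show ?thesis .
qed simp

text \<open>Equality forces the integral of the product gap to be zero, hence the nonnegative gap
  vanishes almost everywhere, and its equality case determines the density.\<close>

lemma primal_eq_dual_imp_gibbs:
  assumes "\<gamma> \<in> pos_measures" "u \<in> Linf \<mu>" "v \<in> Linf \<nu>" "primal_cost \<gamma> = ereal (D u v)"
  shows "\<gamma> = gibbs \<mu> \<nu> c \<epsilon> u v"
proof -
  have "primal_cost \<gamma> \<noteq> \<infinity>" using assms(4) by simp
  note dec = primal_decomposition[OF assms(1) this assms(2,3)]
  have "(\<integral>z. kl_gap (dens \<gamma> \<pi> z) (log_gibbs u v z) \<partial>\<pi>) \<le> 0"
    using dec(3) pos by (simp add: assms(4) mult_le_0_iff)
  then have "(\<integral>z. kl_gap (dens \<gamma> \<pi> z) (log_gibbs u v z) \<partial>\<pi>) = 0"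
    by (intro antisym) (auto simp: kl_gap_nonneg)
  then have "AE z in \<pi>. kl_gap (dens \<gamma> \<pi> z) (log_gibbs u v z) = 0"
    using dec(2) by (subst (asm) integral_nonneg_eq_0_iff_AE) (auto simp: kl_gap_nonneg)
  then have ae: "AE z in \<pi>. dens \<gamma> \<pi> z = exp (log_gibbs u v z)"
    by (simp add: kl_gap_eq_0_iff)
  have [measurable]: "log_gibbs u v \<in> borel_measurable \<pi>"
    using log_gibbs_Linf[OF assms(2,3)] by (rule Linf_borel_measurable)
  have "finite_measure \<gamma>" using assms(1) by (simp add: pos_measures_def)
  then have "\<gamma> = density \<pi> (\<lambda>z. ennreal (dens \<gamma> \<pi> z))"
    using \<pi>.finite_measure_axioms sets_plan[OF assms(1) dec(1)] dec(1)
    by (rule density_dens[symmetric])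
  also have "\<dots> = gibbs \<mu> \<nu> c \<epsilon> u v"
    unfolding gibbs_eq using ae by (intro density_cong) auto
  finally show ?thesis .
qed

section \<open>Optimality conditions\<close>

text \<open>The argument of the logarithm in the transform; at fixed \<open>y\<close> it is the
  coefficient \<open>J\<close> of \<open>transform_strict_optimality\<close>.\<close>

definition slice_mass :: "('a \<Rightarrow> real) \<Rightarrow> 'b \<Rightarrow> real" where
  "slice_mass u y = (\<integral>x. exp ((u x - c (x, y)) / \<epsilon>) \<partial>\<mu>)"

lemma slice_integral:
  "(\<integral>x. exp (log_gibbs u v (x, y)) \<partial>\<mu>) = exp (v y / \<epsilon>) * slice_mass u y"
proof -
  have "exp (log_gibbs u v (x, y)) = exp (v y / \<epsilon>) * exp ((u x - c (x, y)) / \<epsilon>)" for x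
    by (simp add: log_gibbs_def flip: exp_add add_divide_distrib)
  then show ?thesis by (simp add: slice_mass_def)
qed

lemma slice_mass_measurable:
  assumes "u \<in> Linf \<mu>"
  shows "slice_mass u \<in> borel_measurable \<nu>"
proof -
  have [measurable]: "u \<in> borel_measurable \<mu>" using assms by (rule Linf_borel_measurable)
  have "(\<lambda>y. \<integral>x. exp ((u x - c (x, y)) / \<epsilon>) \<partial>\<mu>) \<in> borel_measurable \<nu>" by measurable
  then show ?thesis by (simp add: slice_mass_def[abs_def])
qed

lemma AE_slice_integrable:
  assumes "u \<in> Linf \<mu>" "v \<in> Linf \<nu>"
  shows "AE y in \<nu>. integrable \<mu> (\<lambda>x. exp (log_gibbs u v (x, y)))"
proof -
  have "integrable \<pi> (\<lambda>(x, y). exp (log_gibbs u v (x, y)))"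
    using \<pi>.integrable_Linf[OF Linf_exp[OF log_gibbs_Linf[OF assms]]] by (simp add: split_beta')
  then show ?thesis by (rule P.AE_integrable_snd)
qed

text \<open>An essential bound on the exponent holds on almost every slice, and integrating it
  against \<mu> gives both bounds. The lower one is positive because \<mu> is nonzero, which keeps
  the logarithm in the transform bounded.\<close>

lemma slice_mass_bounds:
  assumes u: "u \<in> Linf \<mu>"
  obtains a b where "a > 0" "AE y in \<nu>. a \<le> slice_mass u y \<and> slice_mass u y \<le> b"
proof -
  \<comment> \<open>With zero as second potential the exponent is exactly that of
    \<open>slice_mass\<close>.\<close>
  let ?w = "log_gibbs u (\<lambda>_. 0)"
  have 0: "(\<lambda>_. 0) \<in> Linf \<nu>" by (auto intro!: LinfI[where K = 0])
  have w: "?w \<in> Linf \<pi>" using log_gibbs_Linf[OF u 0] .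
  then have [measurable]: "?w \<in> borel_measurable \<pi>" by (rule Linf_borel_measurable)
  obtain K where K: "AE z in \<pi>. \<bar>?w z\<bar> \<le> K" using w by (auto simp: Linf_def)
  have "AE x in \<mu>. AE y in \<nu>. \<bar>?w (x, y)\<bar> \<le> K" using K by (rule P.AE_pair)
  \<comment> \<open>Fubini yields the quantifiers with \<open>x\<close> outside; the estimate on a
    slice needs \<open>y\<close> outside.\<close>
  then have ae: "AE y in \<nu>. AE x in \<mu>. \<bar>?w (x, y)\<bar> \<le> K"
    by (subst (asm) P.AE_commute) auto
  define m where "m = measure \<mu> (space \<mu>)"
  have "space \<mu> = UNIV" using sets_\<mu> by (auto dest: sets_eq_imp_space_eq)
  then have "m > 0" using \<mu>_pos by (simp add: m_def M1.emeasure_eq_measure)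
  have "AE y in \<nu>. exp (- K) * m \<le> slice_mass u y \<and> slice_mass u y \<le> exp K * m"
    using ae AE_slice_integrable[OF u 0]
  proof eventually_elim
    case (elim y)
    have s: "slice_mass u y = (\<integral>x. exp (?w (x, y)) \<partial>\<mu>)" using slice_integral[of u "\<lambda>_. 0" y] by simp
    have "(\<integral>x. exp (- K) \<partial>\<mu>) \<le> (\<integral>x. exp (?w (x, y)) \<partial>\<mu>)"
    proof (rule integral_mono_AE)
      show "AE x in \<mu>. exp (- K) \<le> exp (?w (x, y))" using elim(1) by eventually_elim auto
    qed (use elim in auto)
    moreover have "(\<integral>x. exp (?w (x, y)) \<partial>\<mu>) \<le> (\<integral>x. exp K \<partial>\<mu>)"
    proof (rule integral_mono_AE)
      show "AE x in \<mu>. exp (?w (x, y)) \<le> exp K" using elim(1) by eventually_elim auto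
    qed (use elim in auto)
    ultimately show ?case by (simp add: s m_def mult.commute)
  qed
  then show ?thesis using \<open>m > 0\<close> by (intro that[of "exp (- K) * m" "exp K * m"]) auto
qed

abbreviation transform where "transform \<equiv> c_transform_fst \<mu> c \<tau>\<^sub>2 \<epsilon>"

lemma transform_eq: "transform u y = - (\<tau>\<^sub>2 * \<epsilon> / (\<tau>\<^sub>2 + \<epsilon>)) * ln (slice_mass u y)"
  by (simp add: c_transform_fst_def slice_mass_def)

text \<open>Makes the transform an admissible competitor in the dual problem.\<close>

lemma transform_Linf:
  assumes u: "u \<in> Linf \<mu>"
  shows "transform u \<in> Linf \<nu>"
proof -
  obtain a b where ab: "a > 0" "AE y in \<nu>. a \<le> slice_mass u y \<and> slice_mass u y \<le> b"
    using u by (rule slice_mass_bounds)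
  have "AE y in \<nu>. \<bar>ln (slice_mass u y)\<bar> \<le> max \<bar>ln a\<bar> \<bar>ln b\<bar>"
    using ab(2)
  proof eventually_elim
    case (elim y)
    then have "ln a \<le> ln (slice_mass u y)" "ln (slice_mass u y) \<le> ln b" using ab(1) by auto
    then show ?case by linarith
  qed
  then have "(\<lambda>y. ln (slice_mass u y)) \<in> Linf \<nu>"
    using slice_mass_measurable[OF u] by (intro LinfI) auto
  then show ?thesis
    using Linf_cmult[of "\<lambda>y. ln (slice_mass u y)" \<nu> "- (\<tau>\<^sub>2 * \<epsilon> / (\<tau>\<^sub>2 + \<epsilon>))"]
    by (simp add: transform_eq[abs_def])
qed

lemma transform_balance:
  assumes "u \<in> Linf \<mu>"
  shows "AE y in \<nu>. slice_mass u y * exp (transform u y / \<epsilon>) = exp (- transform u y / \<tau>\<^sub>2)"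
proof -
  obtain a b where ab: "a > 0" "AE y in \<nu>. a \<le> slice_mass u y \<and> slice_mass u y \<le> b"
    using assms by (rule slice_mass_bounds)
  from ab(2) show ?thesis
  proof eventually_elim
    case (elim y)
    then show ?case using ab(1) pos by (intro transform_log_identity) (auto simp: transform_eq)
  qed
qed

text \<open>With \<open>u\<close> frozen, Fubini turns the increase of the dual value from
  \<open>v\<close> to the transform into the integral of a pointwise gain. The gain is nonnegative,
  maximality makes its integral nonpositive, so it vanishes almost everywhere and strict concavity
  identifies \<open>v\<close>.\<close>

lemma maximizer_imp_transform:
  assumes u: "u \<in> Linf \<mu>" and v: "v \<in> Linf \<nu>"
    and max: "\<And>v'. v' \<in> Linf \<nu> \<Longrightarrow> D u v' \<le> D u v"
  shows "AE y in \<nu>. transform u y = v y"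
proof -
  let ?T = "transform u"
  have T: "?T \<in> Linf \<nu>" using u by (rule transform_Linf)
  define h where "h t y = \<epsilon> * (exp (t y / \<epsilon>) * slice_mass u y)" for t :: "'b \<Rightarrow> real" and y
  have exp_int: "integrable \<nu> (\<lambda>y. exp (- t y / \<tau>\<^sub>2))" if "t \<in> Linf \<nu>" for t
    using that by (auto intro!: M2.integrable_Linf Linf_exp Linf_divide Linf_uminus)
  have plan_int: "integrable \<pi> (\<lambda>(x, y). exp (log_gibbs u t (x, y)))" if "t \<in> Linf \<nu>" for t
    using \<pi>.integrable_Linf[OF Linf_exp[OF log_gibbs_Linf[OF u that]]] by (simp add: split_beta')
  have h_int: "integrable \<nu> (h t)" if "t \<in> Linf \<nu>" for t
    using P.integrable_snd[OF plan_int[OF that]] by (simp add: h_def[abs_def] slice_integral)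
  have h_eq: "\<epsilon> * (\<integral>z. exp (log_gibbs u t z) \<partial>\<pi>) = (\<integral>y. h t y \<partial>\<nu>)" if "t \<in> Linf \<nu>" for t
    using P.integral_snd[OF plan_int[OF that]] by (simp add: h_def[abs_def] slice_integral split_beta')
  define gain where "gain y = \<tau>\<^sub>2 * (exp (- v y / \<tau>\<^sub>2) - exp (- ?T y / \<tau>\<^sub>2)) +
    \<epsilon> * (exp (v y / \<epsilon>) * slice_mass u y - exp (?T y / \<epsilon>) * slice_mass u y)" for y
  have gain_eq: "gain y = \<tau>\<^sub>2 * (exp (- v y / \<tau>\<^sub>2) - exp (- ?T y / \<tau>\<^sub>2)) + (h v y - h ?T y)" for y
    by (simp add: gain_def h_def right_diff_distrib)
  have int: "integrable \<nu> gain"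
    unfolding gain_eq using exp_int[OF v] exp_int[OF T] h_int[OF v] h_int[OF T] by auto
  have "(\<integral>y. gain y \<partial>\<nu>) = D u ?T - D u v"
    unfolding gain_eq dual_eq[OF u v] dual_eq[OF u T] h_eq[OF v] h_eq[OF T]
    using exp_int[OF v] exp_int[OF T] h_int[OF v] h_int[OF T] by (simp add: algebra_simps)
  then have le: "(\<integral>y. gain y \<partial>\<nu>) \<le> 0" using max[OF T] by simp
  have ge: "AE y in \<nu>. 0 \<le> gain y"
    using transform_balance[OF u]
    by eventually_elim (unfold gain_def, intro transform_strict_optimality(1) pos)
  then have "(\<integral>y. gain y \<partial>\<nu>) = 0" using le by (intro antisym integral_nonneg_AE)
  then have "AE y in \<nu>. gain y = 0"
    using integral_nonneg_eq_0_iff_AE[OF int ge] by simp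
  then show ?thesis
    using transform_balance[OF u]
  proof eventually_elim
    case (elim y)
    then show ?case
      using transform_strict_optimality(2)[OF pos(1,3) elim(2), of "v y"] by (simp add: gain_def)
  qed
qed

text \<open>The balance equation at \<open>v\<close> evaluates the inner integral, which is the
  density of the second marginal of the Gibbs measure.\<close>

lemma transform_imp_slice:
  assumes u: "u \<in> Linf \<mu>" and v: "v \<in> Linf \<nu>" and eq: "AE y in \<nu>. transform u y = v y"
  shows "AE y in \<nu>. (\<integral>\<^sup>+x. ennreal (exp (log_gibbs u v (x, y))) \<partial>\<mu>) = ennreal (exp (- v y / \<tau>\<^sub>2))"
  using eq transform_balance[OF u] AE_slice_integrable[OF u v]
proof eventually_elim
  case (elim y)
  have "(\<integral>\<^sup>+x. ennreal (exp (log_gibbs u v (x, y))) \<partial>\<mu>) = ennreal (\<integral>x. exp (log_gibbs u v (x, y)) \<partial>\<mu>)"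
    using elim(3) by (intro nn_integral_eq_integral) auto
  also have "\<dots> = ennreal (exp (- v y / \<tau>\<^sub>2))"
    using elim(1,2) by (simp add: slice_integral mult.commute)
  finally show ?case .
qed

text \<open>Exchanging the two factors turns each statement about the second potential into the one about
  the first.\<close>

lemma swapped: "entropic_uot \<nu> \<mu> (\<lambda>(y, x). c (x, y)) \<epsilon> \<tau>\<^sub>2 \<tau>\<^sub>1"
proof (unfold_locales)
  obtain K where "AE z in \<pi>. \<bar>c z\<bar> \<le> K" using c_Linf by (auto simp: Linf_def)
  \<comment> \<open>The product measure is the image of the exchanged one under the swap map, so
    almost-everywhere bounds carry over.\<close>
  then have "AE z in distr (\<nu> \<Otimes>\<^sub>M \<mu>) \<pi> (\<lambda>(x, y). (y, x)). \<bar>c z\<bar> \<le> K"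
    by (subst (asm) P.distr_pair_swap)
  then have "AE z in \<nu> \<Otimes>\<^sub>M \<mu>. \<bar>case z of (y, x) \<Rightarrow> c (x, y)\<bar> \<le> K"
    by (subst (asm) AE_distr_iff) (auto simp: split_beta')
  then show "(\<lambda>(y, x). c (x, y)) \<in> Linf (\<nu> \<Otimes>\<^sub>M \<mu>)" by (intro LinfI) auto
qed (use pos sets_\<mu> sets_\<nu> \<mu>_pos \<nu>_pos in auto)

lemma dual_swapped:
  assumes "u \<in> Linf \<mu>" "v \<in> Linf \<nu>"
  shows "dual \<nu> \<mu> (\<lambda>(y, x). c (x, y)) \<epsilon> \<tau>\<^sub>2 \<tau>\<^sub>1 v u = D u v"
proof -
  have "log_gibbs u v \<in> borel_measurable \<pi>"
    using log_gibbs_Linf[OF assms] by (rule Linf_borel_measurable)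
  then have "(\<lambda>z. exp (log_gibbs u v z)) \<in> borel_measurable \<pi>" by simp
  from P.integral_product_swap[OF this] show ?thesis
    by (simp add: dual_def log_gibbs_def split_beta' add.commute)
qed

lemma transform_swapped:
  "c_transform_fst \<nu> (\<lambda>(y, x). c (x, y)) \<tau>\<^sub>1 \<epsilon> v = c_transform_snd \<nu> c \<tau>\<^sub>1 \<epsilon> v"
  by (simp add: fun_eq_iff c_transform_fst_def c_transform_snd_def)

text \<open>A joint maximizer maximizes in each potential separately; the second condition is the
  first one read in the exchanged locale.\<close>

lemma dual_maximizer_imp_maximality:
  assumes "is_dual_maximizer \<mu> \<nu> c \<epsilon> \<tau>\<^sub>1 \<tau>\<^sub>2 u v"
  shows "maximality_condition \<mu> \<nu> c \<epsilon> \<tau>\<^sub>1 \<tau>\<^sub>2 u v"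
proof -
  have u: "u \<in> Linf \<mu>" and v: "v \<in> Linf \<nu>"
    and max: "\<And>u' v'. u' \<in> Linf \<mu> \<Longrightarrow> v' \<in> Linf \<nu> \<Longrightarrow> D u' v' \<le> D u v"
    using assms by (auto simp: is_dual_maximizer_def)
  have "AE y in \<nu>. transform u y = v y"
    using u v max by (intro maximizer_imp_transform)
  moreover have "AE x in \<mu>. c_transform_fst \<nu> (\<lambda>(y, x). c (x, y)) \<tau>\<^sub>1 \<epsilon> v x = u x"
    using u v max by (intro entropic_uot.maximizer_imp_transform[OF swapped]) (auto simp: dual_swapped)
  ultimately show ?thesis by (simp add: maximality_condition_def transform_swapped)
qed

section \<open>The Gibbs measure attains the dual value\<close>

lemma gibbs_in_pos_measures:
  assumes "u \<in> Linf \<mu>" "v \<in> Linf \<nu>"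
  shows "gibbs \<mu> \<nu> c \<epsilon> u v \<in> pos_measures"
proof -
  have w: "log_gibbs u v \<in> Linf \<pi>" using assms by (rule log_gibbs_Linf)
  then have [measurable]: "log_gibbs u v \<in> borel_measurable \<pi>" by (rule Linf_borel_measurable)
  have "integrable \<pi> (\<lambda>z. exp (log_gibbs u v z))" using w by (intro \<pi>.integrable_Linf Linf_exp)
  then have "(\<integral>\<^sup>+z. ennreal (exp (log_gibbs u v z)) \<partial>\<pi>) \<noteq> \<infinity>"
    by (simp add: nn_integral_eq_integral)
  moreover have "emeasure (gibbs \<mu> \<nu> c \<epsilon> u v) (space \<pi>) = (\<integral>\<^sup>+z. ennreal (exp (log_gibbs u v z)) \<partial>\<pi>)"
    unfolding gibbs_eq by (subst emeasure_density) (auto intro!: nn_integral_cong)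
  ultimately have "finite_measure (gibbs \<mu> \<nu> c \<epsilon> u v)"
    by (intro finite_measureI) (simp add: gibbs_eq)
  then show ?thesis by (simp add: pos_measures_def gibbs_eq sets_\<pi>)
qed

text \<open>The maximality condition fixes both marginal densities, and the density on the product
  is known by construction. Each is the exponential of the function it is paired with, so every gap
  vanishes.\<close>

lemma primal_gibbs:
  assumes u: "u \<in> Linf \<mu>" and v: "v \<in> Linf \<nu>"
    and max: "maximality_condition \<mu> \<nu> c \<epsilon> \<tau>\<^sub>1 \<tau>\<^sub>2 u v"
  shows "primal_cost (gibbs \<mu> \<nu> c \<epsilon> u v) = ereal (D u v)"
proof -
  let ?\<gamma> = "gibbs \<mu> \<nu> c \<epsilon> u v"
  note \<gamma> = gibbs_in_pos_measures[OF u v]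
  have fin: "finite_measure ?\<gamma>" using \<gamma> by (simp add: pos_measures_def)
  have w: "log_gibbs u v \<in> Linf \<pi>" using u v by (rule log_gibbs_Linf)
  have [measurable]: "u \<in> borel_measurable \<mu>" "v \<in> borel_measurable \<nu>" "log_gibbs u v \<in> borel_measurable \<pi>"
    using u v w by (auto intro: Linf_borel_measurable)
  have ac: "absolutely_continuous \<pi> ?\<gamma>"
    unfolding gibbs_eq by (intro absolutely_continuousI_density) simp
  have u': "(\<lambda>x. - u x / \<tau>\<^sub>1) \<in> Linf \<mu>" and v': "(\<lambda>y. - v y / \<tau>\<^sub>2) \<in> Linf \<nu>"
    using u v by (auto intro!: Linf_divide Linf_uminus)
  \<comment> \<open>The exchanged locale has its own exponent, with the potentials and the
    coordinates in the other order.\<close>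
  have log_gibbs_swapped: "entropic_uot.log_gibbs (\<lambda>(y, x). c (x, y)) \<epsilon> v u (y, x) = log_gibbs u v (x, y)" for x y
    by (simp add: entropic_uot.log_gibbs_def[OF swapped] log_gibbs_def add.commute)
  have "AE x in \<mu>. (\<integral>\<^sup>+y. ennreal (exp (log_gibbs u v (x, y))) \<partial>\<nu>) = ennreal (exp (- u x / \<tau>\<^sub>1))"
    using entropic_uot.transform_imp_slice[OF swapped v u] max
    by (simp add: log_gibbs_swapped transform_swapped maximality_condition_def)
  then have "distr ?\<gamma> borel fst = density \<mu> (\<lambda>x. ennreal (exp (- u x / \<tau>\<^sub>1)))"
    unfolding gibbs_eq using sets_\<mu>
    by (subst P.distr_density_fst) (auto intro!: density_cong)
  then have 1: "AE x in \<mu>. dens (distr ?\<gamma> borel fst) \<mu> x = exp (- u x / \<tau>\<^sub>1)"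
    using finite_marginals(1)[OF \<gamma> ac] M1.finite_measure_axioms sets_marginals(1)[of ?\<gamma>]
      ac_marginals(1)[OF \<gamma> ac] by (intro dens_unique) auto
  have "AE y in \<nu>. (\<integral>\<^sup>+x. ennreal (exp (log_gibbs u v (x, y))) \<partial>\<mu>) = ennreal (exp (- v y / \<tau>\<^sub>2))"
    using transform_imp_slice[OF u v] max by (simp add: maximality_condition_def)
  then have "distr ?\<gamma> borel snd = density \<nu> (\<lambda>y. ennreal (exp (- v y / \<tau>\<^sub>2)))"
    unfolding gibbs_eq using sets_\<nu>
    by (subst P.distr_density_snd) (auto intro!: density_cong)
  then have 2: "AE y in \<nu>. dens (distr ?\<gamma> borel snd) \<nu> y = exp (- v y / \<tau>\<^sub>2)"
    using finite_marginals(2)[OF \<gamma> ac] M2.finite_measure_axioms sets_marginals(2)[of ?\<gamma>]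
      ac_marginals(2)[OF \<gamma> ac] by (intro dens_unique) auto
  have 3: "AE z in \<pi>. dens ?\<gamma> \<pi> z = exp (log_gibbs u v z)"
    using fin \<pi>.finite_measure_axioms sets_plan[OF \<gamma> ac] ac
    by (intro dens_unique) (auto simp: gibbs_eq)
  show ?thesis
    using primal_eq_dual_plus_gap[OF \<gamma> ac u v]
      integrable_entropy_exp[OF M1.finite_measure_axioms u' borel_measurable_dens 1]
      integrable_entropy_exp[OF M2.finite_measure_axioms v' borel_measurable_dens 2]
      integrable_entropy_exp[OF \<pi>.finite_measure_axioms w borel_measurable_dens 3]
    by simp
qed

end

section \<open>Equivalence of the three conditions and the unique primal minimizer\<close>

theorem proposition2p4:
  fixes \<mu> :: "'a::polish_space measure" and \<nu> :: "'b::polish_space measure"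
    and c :: "'a \<times> 'b \<Rightarrow> real" and \<epsilon> \<tau>\<^sub>1 \<tau>\<^sub>2 :: real
    and u' :: "'a \<Rightarrow> real" and v' :: "'b \<Rightarrow> real"
  assumes "\<epsilon> > 0" and "\<tau>\<^sub>1 > 0" and "\<tau>\<^sub>2 > 0"
    and "\<mu> \<in> pos_measures" and "\<nu> \<in> pos_measures"
    and "emeasure \<mu> UNIV > 0" and "emeasure \<nu> UNIV > 0"
    and "c \<in> Linf (\<mu> \<Otimes>\<^sub>M \<nu>)"
    and "u' \<in> Linf \<mu>" and "v' \<in> Linf \<nu>"
  shows "(is_dual_maximizer \<mu> \<nu> c \<epsilon> \<tau>\<^sub>1 \<tau>\<^sub>2 u' v' \<longleftrightarrow> maximality_condition \<mu> \<nu> c \<epsilon> \<tau>\<^sub>1 \<tau>\<^sub>2 u' v') \<and>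
    (maximality_condition \<mu> \<nu> c \<epsilon> \<tau>\<^sub>1 \<tau>\<^sub>2 u' v' \<longleftrightarrow>
       OT \<mu> \<nu> c \<epsilon> \<tau>\<^sub>1 \<tau>\<^sub>2 = ereal (dual \<mu> \<nu> c \<epsilon> \<tau>\<^sub>1 \<tau>\<^sub>2 u' v')) \<and>
    (maximality_condition \<mu> \<nu> c \<epsilon> \<tau>\<^sub>1 \<tau>\<^sub>2 u' v' \<longrightarrow>
       is_primal_minimizer \<mu> \<nu> c \<epsilon> \<tau>\<^sub>1 \<tau>\<^sub>2 (gibbs \<mu> \<nu> c \<epsilon> u' v') \<and>
       (\<forall>\<gamma>. is_primal_minimizer \<mu> \<nu> c \<epsilon> \<tau>\<^sub>1 \<tau>\<^sub>2 \<gamma> \<longrightarrow> \<gamma> = gibbs \<mu> \<nu> c \<epsilon> u' v'))"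
    (is "(?a \<longleftrightarrow> ?b) \<and> (_ \<longleftrightarrow> ?c) \<and> (_ \<longrightarrow> ?min \<and> ?unique)")
proof -
  interpret M1: finite_measure \<mu> using assms(4) by (simp add: pos_measures_def)
  interpret M2: finite_measure \<nu> using assms(5) by (simp add: pos_measures_def)
  interpret entropic_uot \<mu> \<nu> c \<epsilon> \<tau>\<^sub>1 \<tau>\<^sub>2
    by unfold_locales (use assms in \<open>auto simp: pos_measures_def\<close>)
  note u = assms(9) and v = assms(10)
  have weak: "ereal (D u v) \<le> OT \<mu> \<nu> c \<epsilon> \<tau>\<^sub>1 \<tau>\<^sub>2" if "u \<in> Linf \<mu>" "v \<in> Linf \<nu>" for u v
    unfolding OT_def by (intro INF_greatest weak_duality that)
  have ab: "?a \<Longrightarrow> ?b" by (rule dual_maximizer_imp_maximality)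
  have bc: "?c" if "?b"
  proof (rule antisym)
    show "OT \<mu> \<nu> c \<epsilon> \<tau>\<^sub>1 \<tau>\<^sub>2 \<le> ereal (D u' v')"
      unfolding OT_def primal_gibbs[OF u v that, symmetric]
      by (intro INF_lower gibbs_in_pos_measures u v)
  qed (rule weak[OF u v])
  \<comment> \<open>If the dual value at the given pair equals the primal infimum, weak duality
    bounds every other dual value by it.\<close>
  have ca: "?a" if "?c"
    using weak u v unfolding is_dual_maximizer_def that by auto
  have min: "?min" if "?b"
    using gibbs_in_pos_measures[OF u v] primal_gibbs[OF u v that] bc[OF that]
    by (simp add: is_primal_minimizer_def)
  \<comment> \<open>Any minimizer has primal value equal to the dual value, which is the equality
    case of weak duality.\<close>
  have unique: "?unique" if "?b"
    using primal_eq_dual_imp_gibbs[OF _ u v] bc[OF that] by (simp add: is_primal_minimizer_def)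
  from ab bc ca min unique show ?thesis by blast
qed

end
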